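(* Let $T$ be an algebraic $\sigma$-theory, let $x\le y$ denote a fixed $\sigma$-equation $P(x,y)$ in two variables, and let $t(x,y)$ be a $\sigma$-term such that $x\le y$ is semi-determined by $t$, i.e. $T\vdash x\le y\Rightarrow t(x,y)\approx y$. Put $v(x,y)=t(t(x,y),x)$. Then: \begin{enumerate} \item For every $\sigma$-equation $E(x,y)$: if $T\vdash E(x,t(x,y))$, then $T\vdash x\le y\Rightarrow E(x,y)$. Conversely, if $x\le y$ is strongly determined by $t$ (i.e. in addition $T\vdash x\le t(x,y)$), then $T\vdash x\le y\Rightarrow E(x,y)$ implies $T\vdash E(x,t(x,y))$. \item If $x\le y$ is determined by $t$ (i.e. in addition $T\vdash t(x,y)\approx y\Rightarrow x\le y$), then $T\vdash x\le x$ if and only if $T\vdash t(x,x)\approx x$. \item If $T\vdash v(x,y)\approx v(y,x)$ or $T\vdash v(x,y)\approx t(v(x,y),y)$, then $T\vdash (x\le y\wedge y\le x)\Rightarrow x\approx y$. \item If $T\vdash x\le t(t(x,y),z)$, then $T\vdash (x\le y\wedge y\le z)\Rightarrow x\le z$. Conversely, if $x\le y$ is strongly determined by $t$, then $T\vdash (x\le y\wedge y\le z)\Rightarrow x\le z$ implies $T\vdash x\le t(t(x,y),z)$. \end{enumerate}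
   Context: A signature $\sigma$ is a set of function symbols with arities; $\sigma$-terms are built from a countably infinite set of variables, constant symbols and function symbols; a $\sigma$-equation is an expression $t_1\approx t_2$ of terms; an algebraic $\sigma$-theory $T$ is a set of $\sigma$-equations, and $T\vdash\phi$ means $\phi$ is derivable from $T$ by the usual equational rules (reflexivity, symmetry, transitivity, substitution of equals into terms, and substitution of terms for variables); equivalently $\phi$ holds in every model of $T$. For a set $T'$ of equations and an equation $P(x_1,\dots,x_n)$, "$T\vdash \bigwedge T'\Rightarrow P$" means: after adjoining pairwise distinct fresh constant symbols $a_1,a_2,\dots$ (not occurring in $\sigma$), $T\cup\{Q(a_1,\dots,a_m)\mid Q(x_1,\dots,x_m)\in T'\}\vdash P(a_1,\dots,a_n)$. A conjunction $(Q_1\wedge\dots\wedge Q_k)\Rightarrow P$ denotes this with $T'=\{Q_1,\dots,Q_k\}$. Writing $x\le z$, $x\le t(x,y)$ etc. means the equation $P$ with the indicated terms substituted. *)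

theory Defs
  imports Main
begin

text \<open>A signature is a set of function symbols (the domain of the map) with arities;
  constant symbols are the symbols of arity 0. The variables are the natural numbers.\<close>

type_synonym 'f signature = "'f \<rightharpoonup> nat"

datatype 'f trm = Var nat | Fun 'f "'f trm list"

datatype 'f eqn = Eqn "'f trm" "'f trm" (infix "\<approx>" 55)

fun is_term :: "'f signature \<Rightarrow> 'f trm \<Rightarrow> bool" where
  "is_term \<sigma> (Var i) \<longleftrightarrow> True"
| "is_term \<sigma> (Fun f ts) \<longleftrightarrow> \<sigma> f = Some (length ts) \<and> (\<forall>t\<in>set ts. is_term \<sigma> t)"

fun is_eqn :: "'f signature \<Rightarrow> 'f eqn \<Rightarrow> bool" where
  "is_eqn \<sigma> (s \<approx> t) \<longleftrightarrow> is_term \<sigma> s \<and> is_term \<sigma> t"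

definition is_theory :: "'f signature \<Rightarrow> 'f eqn set \<Rightarrow> bool" where
  "is_theory \<sigma> T \<longleftrightarrow> (\<forall>\<phi>\<in>T. is_eqn \<sigma> \<phi>)"

fun vars :: "'f trm \<Rightarrow> nat set" where
  "vars (Var i) = {i}"
| "vars (Fun f ts) = (\<Union>t\<in>set ts. vars t)"

fun vars_eqn :: "'f eqn \<Rightarrow> nat set" where
  "vars_eqn (s \<approx> t) = vars s \<union> vars t"

fun subst :: "(nat \<Rightarrow> 'f trm) \<Rightarrow> 'f trm \<Rightarrow> 'f trm" where
  "subst \<theta> (Var i) = \<theta> i"
| "subst \<theta> (Fun f ts) = Fun f (map (subst \<theta>) ts)"

fun subst_eqn :: "(nat \<Rightarrow> 'f trm) \<Rightarrow> 'f eqn \<Rightarrow> 'f eqn" where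
  "subst_eqn \<theta> (s \<approx> t) = subst \<theta> s \<approx> subst \<theta> t"

inductive derives :: "'f signature \<Rightarrow> 'f eqn set \<Rightarrow> 'f eqn \<Rightarrow> bool"
  for \<sigma> :: "'f signature" and T :: "'f eqn set" where
  ax: "\<phi> \<in> T \<Longrightarrow> derives \<sigma> T \<phi>"
| refl: "is_term \<sigma> t \<Longrightarrow> derives \<sigma> T (t \<approx> t)"
| sym: "derives \<sigma> T (s \<approx> t) \<Longrightarrow> derives \<sigma> T (t \<approx> s)"
| trans: "derives \<sigma> T (s \<approx> t) \<Longrightarrow> derives \<sigma> T (t \<approx> u) \<Longrightarrow> derives \<sigma> T (s \<approx> u)"
| cong: "is_term \<sigma> r \<Longrightarrow> (\<And>i. i \<in> vars r \<Longrightarrow> derives \<sigma> T (\<theta> i \<approx> \<theta>' i)) \<Longrightarrow>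
    derives \<sigma> T (subst \<theta> r \<approx> subst \<theta>' r)"
| inst: "derives \<sigma> T \<phi> \<Longrightarrow> (\<And>i. is_term \<sigma> (\<theta> i)) \<Longrightarrow> derives \<sigma> T (subst_eqn \<theta> \<phi>)"

text \<open>Fresh constants \<open>a\<^sub>i\<close>, one for each variable, are adjoined as the symbols \<open>Inr i\<close>;
  the old symbols \<open>f\<close> become \<open>Inl f\<close>.\<close>

definition add_consts :: "'f signature \<Rightarrow> ('f + nat) signature" where
  "add_consts \<sigma> = case_sum \<sigma> (\<lambda>_. Some 0)"

definition at_consts :: "'f eqn \<Rightarrow> ('f + nat) eqn" where
  "at_consts \<phi> = subst_eqn (\<lambda>i. Fun (Inr i) []) (map_eqn Inl \<phi>)"

definition derives_imp :: "'f signature \<Rightarrow> 'f eqn set \<Rightarrow> 'f eqn set \<Rightarrow> 'f eqn \<Rightarrow> bool" where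
  "derives_imp \<sigma> T T' P \<longleftrightarrow>
    derives (add_consts \<sigma>) (map_eqn Inl ` T \<union> at_consts ` T') (at_consts P)"

text \<open>For \<open>t = t(x,y)\<close>, the term \<open>t(s,u)\<close>; similarly for equations.\<close>

definition trm_at :: "nat \<Rightarrow> nat \<Rightarrow> 'f trm \<Rightarrow> 'f trm \<Rightarrow> 'f trm \<Rightarrow> 'f trm" where
  "trm_at x y t s u = subst (Var(x := s, y := u)) t"

definition eqn_at :: "nat \<Rightarrow> nat \<Rightarrow> 'f eqn \<Rightarrow> 'f trm \<Rightarrow> 'f trm \<Rightarrow> 'f eqn" where
  "eqn_at x y P s u = subst_eqn (Var(x := s, y := u)) P"

definition semi_determined ::
  "'f signature \<Rightarrow> 'f eqn set \<Rightarrow> nat \<Rightarrow> nat \<Rightarrow> 'f eqn \<Rightarrow> 'f trm \<Rightarrow> bool" where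
  "semi_determined \<sigma> T x y P t \<longleftrightarrow> derives_imp \<sigma> T {P} (t \<approx> Var y)"

definition determined ::
  "'f signature \<Rightarrow> 'f eqn set \<Rightarrow> nat \<Rightarrow> nat \<Rightarrow> 'f eqn \<Rightarrow> 'f trm \<Rightarrow> bool" where
  "determined \<sigma> T x y P t \<longleftrightarrow>
    semi_determined \<sigma> T x y P t \<and> derives_imp \<sigma> T {t \<approx> Var y} P"

definition strongly_determined ::
  "'f signature \<Rightarrow> 'f eqn set \<Rightarrow> nat \<Rightarrow> nat \<Rightarrow> 'f eqn \<Rightarrow> 'f trm \<Rightarrow> bool" where
  "strongly_determined \<sigma> T x y P t \<longleftrightarrow>
    semi_determined \<sigma> T x y P t \<and> derives \<sigma> T (eqn_at x y P (Var x) t)"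

end

theory Submission
  imports Defs
begin

text \<open>Everything rests on the fact that fresh constants can be replaced by arbitrary terms: an
  implication \<open>T \<turnstile> \<And>T' \<Rightarrow> P\<close> yields every instance of \<open>P\<close> for which the corresponding
  instances of \<open>T'\<close> are derivable, over any signature into which the given one maps.
  The forward implications then replace \<open>t(a,b)\<close> by \<open>b\<close> whenever \<open>a \<le> b\<close>; the converse ones
  specialise the constant for \<open>y\<close> to \<open>t(x,y)\<close>, and in the transitivity clause also the one for
  \<open>z\<close> to \<open>t(t(x,y),z)\<close>, for which strong determination provides the premises.\<close>

section \<open>Substitution and renaming of function symbols\<close>

lemma subst_cong_vars: "(\<And>i. i \<in> vars r \<Longrightarrow> \<theta> i = \<theta>' i) \<Longrightarrow> subst \<theta> r = subst \<theta>' r"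
  by (induction r) auto

lemma subst_Var: "subst Var r = r"
  by (induction r) (auto intro: map_idI)

lemma subst_subst: "subst \<theta> (subst \<rho> r) = subst (\<lambda>i. subst \<theta> (\<rho> i)) r"
  by (induction r) auto

lemma map_trm_subst: "map_trm h (subst \<theta> r) = subst (\<lambda>i. map_trm h (\<theta> i)) (map_trm h r)"
  by (induction r) auto

lemma vars_map_trm: "vars (map_trm h r) = vars r"
  by (induction r) auto

lemma subst_eqn_cong_vars:
  "(\<And>i. i \<in> vars_eqn E \<Longrightarrow> \<theta> i = \<theta>' i) \<Longrightarrow> subst_eqn \<theta> E = subst_eqn \<theta>' E"
  by (cases E) (auto intro: subst_cong_vars)

lemma subst_eqn_Var: "subst_eqn Var E = E"
  by (cases E) (simp add: subst_Var)

lemma subst_eqn_subst_eqn: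
  "subst_eqn \<theta> (subst_eqn \<rho> E) = subst_eqn (\<lambda>i. subst \<theta> (\<rho> i)) E"
  by (cases E) (simp add: subst_subst)

lemma map_eqn_subst_eqn:
  "map_eqn h (subst_eqn \<theta> E) = subst_eqn (\<lambda>i. map_trm h (\<theta> i)) (map_eqn h E)"
  by (cases E) (simp add: map_trm_subst)

lemma is_term_subst:
  "is_term \<sigma> r \<Longrightarrow> (\<And>i. i \<in> vars r \<Longrightarrow> is_term \<sigma> (\<theta> i)) \<Longrightarrow> is_term \<sigma> (subst \<theta> r)"
  by (induction r) auto

section \<open>Derivations along maps of signatures\<close>

text \<open>Morphisms of signatures. The two instances that occur are \<open>id\<close> and the
  embedding \<open>Inl\<close> into the signature with fresh constants.\<close>

definition arity_preserving :: "('f \<Rightarrow> 'g) \<Rightarrow> 'f signature \<Rightarrow> 'g signature \<Rightarrow> bool" where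
  "arity_preserving h \<sigma> \<tau> \<longleftrightarrow> (\<forall>f n. \<sigma> f = Some n \<longrightarrow> \<tau> (h f) = Some n)"

lemma arity_preserving_id: "arity_preserving id \<sigma> \<sigma>"
  by (simp add: arity_preserving_def)

lemma arity_preserving_Inl: "arity_preserving Inl \<sigma> (add_consts \<sigma>)"
  by (simp add: arity_preserving_def add_consts_def)

lemma is_term_map_trm:
  "arity_preserving h \<sigma> \<tau> \<Longrightarrow> is_term \<sigma> r \<Longrightarrow> is_term \<tau> (map_trm h r)"
  by (induction r) (auto simp: arity_preserving_def)

lemma is_eqn_map_eqn:
  "arity_preserving h \<sigma> \<tau> \<Longrightarrow> is_eqn \<sigma> E \<Longrightarrow> is_eqn \<tau> (map_eqn h E)"
  by (cases E) (simp add: is_term_map_trm)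

text \<open>Every rule is stable under renaming symbols; the axioms need only become derivable from
  \<open>S\<close>, so \<open>S\<close> may contain further equations.\<close>

lemma derives_map_eqn:
  assumes h: "arity_preserving h \<sigma> \<tau>" and T: "\<And>\<psi>. \<psi> \<in> T \<Longrightarrow> derives \<tau> S (map_eqn h \<psi>)"
    and "derives \<sigma> T \<phi>"
  shows "derives \<tau> S (map_eqn h \<phi>)"
  using assms(3)
proof (induction rule: derives.induct)
  case (cong r \<theta> \<theta>')
  then show ?case
    by (auto simp: map_trm_subst vars_map_trm intro!: derives.cong is_term_map_trm[OF h])
next
  case (inst \<phi> \<theta>)
  then show ?case
    by (auto simp: map_eqn_subst_eqn intro!: derives.inst is_term_map_trm[OF h])
qed (auto intro: T derives.intros is_term_map_trm[OF h])

text \<open>The rule \<open>cong\<close> substitutes into one fixed term. Here that term is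
  \<open>f\<close> applied to distinct variables, with \<open>ss\<close> and \<open>us\<close> as
  the two assignments.\<close>

lemma derives_Fun_cong:
  assumes "\<tau> f = Some (length ss)" and "list_all2 (\<lambda>s u. derives \<tau> S (s \<approx> u)) ss us"
  shows "derives \<tau> S (Fun f ss \<approx> Fun f us)"
proof -
  let ?r = "Fun f (map Var [0..<length ss])"
  have len: "length us = length ss"
    using assms(2) by (simp add: list_all2_lengthD)
  have "derives \<tau> S (subst ((!) ss) ?r \<approx> subst ((!) us) ?r)"
    using assms by (intro derives.cong) (auto simp: list_all2_conv_all_nth)
  moreover have "map (subst ((!) ss)) (map Var [0..<length ss]) = ss"
    by (simp add: comp_def map_nth)
  moreover have "map (subst ((!) us)) (map Var [0..<length ss]) = us"
    by (simp add: comp_def map_nth flip: len)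
  ultimately show ?thesis
    by (simp only: subst.simps)
qed

lemma derives_replace:
  assumes "derives \<sigma> T (subst_eqn \<theta> E)" and "is_eqn \<sigma> E"
    and eq: "\<And>i. i \<in> vars_eqn E \<Longrightarrow> derives \<sigma> T (\<theta> i \<approx> \<theta>' i)"
  shows "derives \<sigma> T (subst_eqn \<theta>' E)"
proof (cases E)
  case (Eqn r s)
  have "derives \<sigma> T (subst \<theta> r \<approx> subst \<theta>' r)" "derives \<sigma> T (subst \<theta> s \<approx> subst \<theta>' s)"
    using assms Eqn by (auto intro: derives.cong)
  with assms(1) Eqn show ?thesis
    by (auto intro: derives.sym derives.trans)
qed

section \<open>Replacing the fresh constants by terms\<close>

text \<open>The variables get their own assignment \<open>\<rho>\<close>, apart from the terms \<open>c\<close> substituted for the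
  constants: the rule \<open>inst\<close> must not touch variables that occur in \<open>c i\<close>.\<close>

fun replace_consts ::
  "('f \<Rightarrow> 'g) \<Rightarrow> (nat \<Rightarrow> 'g trm) \<Rightarrow> (nat \<Rightarrow> 'g trm) \<Rightarrow> ('f + nat) trm \<Rightarrow> 'g trm" where
  "replace_consts h c \<rho> (Var i) = \<rho> i"
| "replace_consts h c \<rho> (Fun (Inl f) ts) = Fun (h f) (map (replace_consts h c \<rho>) ts)"
| "replace_consts h c \<rho> (Fun (Inr i) ts) = c i"

fun replace_consts_eqn ::
  "('f \<Rightarrow> 'g) \<Rightarrow> (nat \<Rightarrow> 'g trm) \<Rightarrow> (nat \<Rightarrow> 'g trm) \<Rightarrow> ('f + nat) eqn \<Rightarrow> 'g eqn" where
  "replace_consts_eqn h c \<rho> (s \<approx> u) = replace_consts h c \<rho> s \<approx> replace_consts h c \<rho> u"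

lemma replace_consts_subst:
  "replace_consts h c \<rho> (subst \<theta> r) = replace_consts h c (\<lambda>i. replace_consts h c \<rho> (\<theta> i)) r"
  by (induction h c \<rho> r rule: replace_consts.induct) auto

lemma replace_consts_eqn_subst_eqn:
  "replace_consts_eqn h c \<rho> (subst_eqn \<theta> E) =
    replace_consts_eqn h c (\<lambda>i. replace_consts h c \<rho> (\<theta> i)) E"
  by (cases E) (simp add: replace_consts_subst)

lemma replace_consts_map_Inl: "replace_consts h c \<rho> (map_trm Inl r) = subst \<rho> (map_trm h r)"
  by (induction r) auto

lemma replace_consts_eqn_map_Inl:
  "replace_consts_eqn h c \<rho> (map_eqn Inl E) = subst_eqn \<rho> (map_eqn h E)"
  by (cases E) (simp add: replace_consts_map_Inl)

text \<open>No variables are left in \<open>at_consts E\<close>, so the assignment \<rho>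
  disappears.\<close>

lemma replace_consts_eqn_at_consts:
  "replace_consts_eqn h c \<rho> (at_consts E) = subst_eqn c (map_eqn h E)"
  by (simp add: at_consts_def replace_consts_eqn_subst_eqn replace_consts_eqn_map_Inl)

lemma is_term_replace_consts:
  assumes "arity_preserving h \<sigma> \<tau>" and "\<And>i. is_term \<tau> (c i)" and "\<And>i. is_term \<tau> (\<rho> i)"
  shows "is_term (add_consts \<sigma>) r \<Longrightarrow> is_term \<tau> (replace_consts h c \<rho> r)"
  using assms
  by (induction h c \<rho> r rule: replace_consts.induct)
    (auto simp: arity_preserving_def add_consts_def)

text \<open>Serves the rule \<open>cong\<close> under replacement of constants: old symbols are
  handled by \<open>derives_Fun_cong\<close>, while a constant becomes the same term
  \<open>c i\<close> on both sides.\<close>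

lemma derives_replace_consts_cong:
  assumes h: "arity_preserving h \<sigma> \<tau>" and c: "\<And>i. is_term \<tau> (c i)"
  shows "is_term (add_consts \<sigma>) r \<Longrightarrow> (\<And>i. i \<in> vars r \<Longrightarrow> derives \<tau> S (\<rho> i \<approx> \<rho>' i)) \<Longrightarrow>
    derives \<tau> S (replace_consts h c \<rho> r \<approx> replace_consts h c \<rho>' r)"
proof (induction r)
  case (Var i)
  then show ?case by simp
next
  case (Fun g ts)
  show ?case
  proof (cases g)
    case (Inl f)
    have "\<tau> (h f) = Some (length ts)"
      using Fun.prems(1) Inl h by (simp add: add_consts_def arity_preserving_def)
    moreover have "derives \<tau> S (replace_consts h c \<rho> u \<approx> replace_consts h c \<rho>' u)"
      if "u \<in> set ts" for u
      by (rule Fun.IH[OF that]) (use Fun.prems that in auto)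
    ultimately show ?thesis
      using Inl
      by (auto intro!: derives_Fun_cong simp: list_all2_map1 list_all2_map2 list_all2_same)
  next
    case (Inr i)
    then show ?thesis by (simp add: c derives.refl)
  qed
qed

lemma derives_imp_instance:
  assumes imp: "derives_imp \<sigma> T T' E"
    and h: "arity_preserving h \<sigma> \<tau>"
    and T: "\<And>\<psi>. \<psi> \<in> T \<Longrightarrow> derives \<tau> S (map_eqn h \<psi>)"
    and c: "\<And>i. is_term \<tau> (c i)"
    and T': "\<And>Q. Q \<in> T' \<Longrightarrow> derives \<tau> S (subst_eqn c (map_eqn h Q))"
  shows "derives \<tau> S (subst_eqn c (map_eqn h E))"
proof -
  have "derives \<tau> S (replace_consts_eqn h c \<rho> \<phi>)"
    if "derives (add_consts \<sigma>) (map_eqn Inl ` T \<union> at_consts ` T') \<phi>" "\<And>i. is_term \<tau> (\<rho> i)"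
    for \<phi> \<rho>
    using that
  \<comment> \<open>The claim is proved for all \<rho> at once: an \<open>inst\<close> step by
    \<theta> is absorbed by passing to the assignment that sends \<open>i\<close> to the translation
    of \<open>\<theta> i\<close>.\<close>
  proof (induction arbitrary: \<rho> rule: derives.induct)
    case (ax \<phi>)
    have "derives \<tau> S (subst_eqn \<rho> (map_eqn h \<psi>))" if "\<psi> \<in> T" for \<psi>
      by (rule derives.inst[OF T[OF that] ax.prems])
    with ax.hyps show ?case
      by (auto simp: replace_consts_eqn_map_Inl replace_consts_eqn_at_consts T')
  next
    case (refl r)
    then show ?case
      by (simp add: derives.refl is_term_replace_consts[OF h c])
  next
    case (sym s u)
    then show ?case by (auto intro: derives.sym)
  next
    case (trans s u w)
    then show ?case by (auto intro: derives.trans)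
  next
    case (cong r \<theta> \<theta>')
    then show ?case
      by (auto simp: replace_consts_subst intro!: derives_replace_consts_cong[OF h c])
  next
    case (inst \<phi> \<theta>)
    then show ?case
      by (simp add: replace_consts_eqn_subst_eqn is_term_replace_consts[OF h c])
  qed
  from this[where \<rho> = Var, OF imp[unfolded derives_imp_def]] show ?thesis
    by (simp add: replace_consts_eqn_at_consts)
qed

corollary derives_imp_terms:
  assumes "derives_imp \<sigma> T T' E" and "\<And>i. is_term \<sigma> (c i)"
    and "\<And>Q. Q \<in> T' \<Longrightarrow> derives \<sigma> T (subst_eqn c Q)"
  shows "derives \<sigma> T (subst_eqn c E)"
  using derives_imp_instance[OF assms(1) arity_preserving_id, where S = T and c = c] assms(2,3)
  by (simp add: eqn.map_id derives.ax)

theorem mainTheorem1: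
  fixes \<sigma> :: "'f signature" and T :: "'f eqn set"
    and x y z :: nat and P :: "'f eqn" and t :: "'f trm"
  assumes "is_theory \<sigma> T"
    and "distinct [x, y, z]"
    and "is_eqn \<sigma> P" and "vars_eqn P \<subseteq> {x, y}"
    and "is_term \<sigma> t" and "vars t \<subseteq> {x, y}"
    and "semi_determined \<sigma> T x y P t"
  shows "let X = Var x; Y = Var y; Z = Var z;
             le = eqn_at x y P; tt = trm_at x y t; v = (\<lambda>s u. tt (tt s u) s) in
     (\<forall>E. is_eqn \<sigma> E \<and> vars_eqn E \<subseteq> {x, y} \<longrightarrow>
        (derives \<sigma> T (eqn_at x y E X (tt X Y)) \<longrightarrow> derives_imp \<sigma> T {le X Y} E) \<and>
        (strongly_determined \<sigma> T x y P t \<longrightarrow>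
          derives_imp \<sigma> T {le X Y} E \<longrightarrow> derives \<sigma> T (eqn_at x y E X (tt X Y)))) \<and>
     (determined \<sigma> T x y P t \<longrightarrow>
        (derives \<sigma> T (le X X) \<longleftrightarrow> derives \<sigma> T (tt X X \<approx> X))) \<and>
     (derives \<sigma> T (v X Y \<approx> v Y X) \<or> derives \<sigma> T (v X Y \<approx> tt (v X Y) Y) \<longrightarrow>
        derives_imp \<sigma> T {le X Y, le Y X} (X \<approx> Y)) \<and>
     (derives \<sigma> T (le X (tt (tt X Y) Z)) \<longrightarrow>
        derives_imp \<sigma> T {le X Y, le Y Z} (le X Z)) \<and>
     (strongly_determined \<sigma> T x y P t \<longrightarrow>
        derives_imp \<sigma> T {le X Y, le Y Z} (le X Z) \<longrightarrow>
        derives \<sigma> T (le X (tt (tt X Y) Z)))"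
proof -

  \<comment> \<open>Evaluation at the fresh constants\<close>
  define le where "le = eqn_at x y P"
  define tt where "tt = trm_at x y t"
  define v where "v = (\<lambda>s u. tt (tt s u) s)"
  define A :: "nat \<Rightarrow> ('f + nat) trm" where "A = (\<lambda>i. Fun (Inr i) [])"
  \<comment> \<open>Updating \<open>A\<close> rather than \<open>Var\<close> sends all other
    variables to their constants, just as \<open>at_consts\<close> does, so the evaluation rules
    below are literal equalities.\<close>
  define q where "q s u = subst (A(x := s, y := u)) (map_trm Inl t)" for s u
  define p where "p s u = subst_eqn (A(x := s, y := u)) (map_eqn Inl P)" for s u
  define H where "H T' = map_eqn Inl ` T \<union> at_consts ` T'" for T'
  let ?\<tau> = "add_consts \<sigma>"
  let ?X = "Var x" and ?Y = "Var y" and ?Z = "Var z"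
  have ne: "x \<noteq> y" "x \<noteq> z" "y \<noteq> z"
    using assms(2) by auto
  have tt_XY: "tt ?X ?Y = t" and le_XY: "le ?X ?Y = P"
    by (simp_all add: tt_def le_def trm_at_def eqn_at_def subst_Var subst_eqn_Var)
  have A_term: "is_term ?\<tau> (A i)" for i
    by (simp add: A_def add_consts_def)
  have at_A: "at_consts E = subst_eqn A (map_eqn Inl E)" for E :: "'f eqn"
    by (simp add: at_consts_def A_def)
  have eval_eqn: "at_consts (eqn_at x y E s u) =
      subst_eqn (A(x := subst A (map_trm Inl s), y := subst A (map_trm Inl u))) (map_eqn Inl E)"
    for E s u
    by (simp add: at_A eqn_at_def map_eqn_subst_eqn subst_eqn_subst_eqn)
      (rule subst_eqn_cong_vars, simp)
  have eval_tt: "subst A (map_trm Inl (tt s u)) =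
      q (subst A (map_trm Inl s)) (subst A (map_trm Inl u))" for s u
    by (simp add: tt_def q_def trm_at_def map_trm_subst subst_subst)
      (rule subst_cong_vars, simp)
  have eval_le: "at_consts (le s u) = p (subst A (map_trm Inl s)) (subst A (map_trm Inl u))" for s u
    by (simp add: le_def p_def eval_eqn)
  have at_Eqn: "at_consts (s \<approx> u) = subst A (map_trm Inl s) \<approx> subst A (map_trm Inl u)"
    for s u :: "'f trm"
    by (simp add: at_A)
  have H_T: "derives ?\<tau> (H T') (map_eqn Inl \<psi>)" if "\<psi> \<in> T" for \<psi> T'
    using that by (auto simp: H_def intro: derives.ax)
  have H_prem: "derives ?\<tau> (H T') (at_consts Q)" if "Q \<in> T'" for Q T'
    using that by (auto simp: H_def intro: derives.ax)
  have lift: "derives ?\<tau> (H T') (at_consts \<phi>)" if "derives \<sigma> T \<phi>" for \<phi> T'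
    unfolding at_A
    by (intro derives.inst A_term derives_map_eqn[OF arity_preserving_Inl H_T that])
  have imp_iff: "derives_imp \<sigma> T T' E \<longleftrightarrow> derives ?\<tau> (H T') (at_consts E)" for T' E
    by (simp add: derives_imp_def H_def)
  have semi: "derives_imp \<sigma> T {P} (t \<approx> ?Y)"
    using assms(7) by (simp add: semi_determined_def)
  \<comment> \<open>Semi-determination speaks only of the constants for \<open>x\<close> and
    \<open>y\<close>. Instantiating it inside the extended signature itself extends it to arbitrary
    terms, in particular to other pairs of constants.\<close>
  have absorb: "derives ?\<tau> (H T') (q s u \<approx> u)"
    if "derives ?\<tau> (H T') (p s u)" "is_term ?\<tau> s" "is_term ?\<tau> u" for T' s u
  proof -
    have "derives ?\<tau> (H T') (subst_eqn (A(x := s, y := u)) (map_eqn Inl (t \<approx> ?Y)))"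
      using that A_term
      by (intro derives_imp_instance[OF semi arity_preserving_Inl H_T]) (auto simp: p_def)
    then show ?thesis by (simp add: q_def)
  qed
  have q_cong: "derives ?\<tau> (H T') (q s u \<approx> q s' u')"
    if "derives ?\<tau> (H T') (s \<approx> s')" "derives ?\<tau> (H T') (u \<approx> u')" for T' s s' u u'
    unfolding q_def using that A_term
    by (intro derives.cong is_term_map_trm[OF arity_preserving_Inl assms(5)])
      (auto intro: derives.refl)
  have A_refl: "derives ?\<tau> (H T') (A i \<approx> A i)" for T' i
    by (simp add: derives.refl A_term)
  have le_absorb: "derives ?\<tau> (H T') (q (A i) (A j) \<approx> A j)" if "le (Var i) (Var j) \<in> T'" for T' i j
    using absorb[OF _ A_term A_term] H_prem[OF that] by (simp add: eval_le)
  note eval = eval_le eval_tt eval_eqn at_Eqn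

  \<comment> \<open>Clause 1: equations between \<open>x\<close> and \<open>t(x,y)\<close>\<close>
  have replace_second: "derives ?\<tau> S (subst_eqn (A(x := A x, y := w)) (map_eqn Inl E))"
    if "derives ?\<tau> S (subst_eqn (A(x := A x, y := u)) (map_eqn Inl E))" "is_eqn \<sigma> E"
      "derives ?\<tau> S (u \<approx> w)" for S E u w
    by (rule derives_replace[OF that(1)])
      (use that A_term in \<open>auto intro: is_eqn_map_eqn[OF arity_preserving_Inl] derives.refl\<close>)

  have E_forward: "derives_imp \<sigma> T {le ?X ?Y} E"
    if "is_eqn \<sigma> E" and E: "derives \<sigma> T (eqn_at x y E ?X (tt ?X ?Y))" for E
  proof -
    have "derives ?\<tau> (H {le ?X ?Y}) (subst_eqn (A(x := A x, y := A y)) (map_eqn Inl E))"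
      by (rule replace_second[OF _ that(1) le_absorb])
        (use lift[OF E, of "{le ?X ?Y}"] in \<open>simp_all add: eval\<close>)
    then show ?thesis by (simp add: imp_iff at_A)
  qed

  have E_backward: "derives \<sigma> T (eqn_at x y E ?X (tt ?X ?Y))"
    if "strongly_determined \<sigma> T x y P t" and E: "derives_imp \<sigma> T {le ?X ?Y} E" for E
  proof -
    have "derives \<sigma> T (subst_eqn (Var(y := t)) P)"
      using that(1) by (simp add: strongly_determined_def eqn_at_def)
    \<comment> \<open>Sending \<open>y\<close> to \<open>t(x,y)\<close> turns the premise into x <=
      t(x,y), which is what strong determination supplies.\<close>
    with derives_imp_terms[OF E, of "Var(y := t)"] assms(5) show ?thesis
      by (simp add: eqn_at_def tt_XY le_XY)
  qed

  \<comment> \<open>Clause 2: reflexivity\<close>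
  have reflexive: "derives \<sigma> T (le ?X ?X) \<longleftrightarrow> derives \<sigma> T (tt ?X ?X \<approx> ?X)"
    if "determined \<sigma> T x y P t"
  proof -
    have conv: "derives_imp \<sigma> T {t \<approx> ?Y} P"
      using that by (simp add: determined_def)
    show ?thesis
      \<comment> \<open>Identifying \<open>y\<close> with \<open>x\<close> in the two implications
        that make up determination gives one direction each.\<close>
      using derives_imp_terms[OF semi, of "Var(y := ?X)"] derives_imp_terms[OF conv, of "Var(y := ?X)"]
      by (auto simp: le_def tt_def eqn_at_def trm_at_def)
  qed

  \<comment> \<open>Clause 3: antisymmetry\<close>
  have antisymmetric: "derives_imp \<sigma> T {le ?X ?Y, le ?Y ?X} (?X \<approx> ?Y)"
    if "derives \<sigma> T (v ?X ?Y \<approx> v ?Y ?X) \<or> derives \<sigma> T (v ?X ?Y \<approx> tt (v ?X ?Y) ?Y)"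
  proof -
    define D where "D s u \<longleftrightarrow> derives ?\<tau> (H {le ?X ?Y, le ?Y ?X}) (s \<approx> u)" for s u
    have tr: "D s w" if "D s u" "D u w" for s u w
      using that unfolding D_def by (rule derives.trans)
    have sy: "D u s" if "D s u" for s u
      using that unfolding D_def by (rule derives.sym)
    have cg: "D (q s u) (q s' u')" if "D s s'" "D u u'" for s s' u u'
      using that unfolding D_def by (rule q_cong)
    have rf: "D (A i) (A i)" for i
      by (simp add: D_def A_refl)
    have xy: "D (q (A x) (A y)) (A y)" and yx: "D (q (A y) (A x)) (A x)"
      by (simp_all add: D_def le_absorb)
    \<comment> \<open>With a, b the constants for \<open>x\<close>, \<open>y\<close>: t(a,b) = b
      gives v(a,b) = t(b,a) = a, and symmetrically v(b,a) = b.\<close>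
    have vx: "D (q (q (A x) (A y)) (A x)) (A x)"
      by (rule tr[OF cg[OF xy rf] yx])
    have vy: "D (q (q (A y) (A x)) (A y)) (A y)"
      by (rule tr[OF cg[OF yx rf] xy])
    from that have "D (A x) (A y)"
    proof
      assume "derives \<sigma> T (v ?X ?Y \<approx> v ?Y ?X)"
      from lift[OF this] have "D (q (q (A x) (A y)) (A x)) (q (q (A y) (A x)) (A y))"
        by (simp add: D_def v_def eval)
      then show ?thesis using tr sy vx vy by blast
    next
      assume "derives \<sigma> T (v ?X ?Y \<approx> tt (v ?X ?Y) ?Y)"
      from lift[OF this]
      have "D (q (q (A x) (A y)) (A x)) (q (q (q (A x) (A y)) (A x)) (A y))"
        by (simp add: D_def v_def eval)
      \<comment> \<open>Since v(a,b) = a, the right-hand side t(v(a,b),b) reduces to t(a,b) =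
        b.\<close>
      moreover have "D (q (q (q (A x) (A y)) (A x)) (A y)) (A y)"
        by (rule tr[OF cg[OF vx rf] xy])
      ultimately show ?thesis using tr sy vx by blast
    qed
    then show ?thesis by (simp add: imp_iff D_def eval)
  qed

  \<comment> \<open>Clause 4: transitivity\<close>
  have trans_forward: "derives_imp \<sigma> T {le ?X ?Y, le ?Y ?Z} (le ?X ?Z)"
    if le: "derives \<sigma> T (le ?X (tt (tt ?X ?Y) ?Z))"
  proof -
    let ?S = "H {le ?X ?Y, le ?Y ?Z}"
    \<comment> \<open>Absorption is used twice: t(t(a,b),c) = t(b,c) = c for the constants a, b, c
      of \<open>x\<close>, \<open>y\<close>, \<open>z\<close>.\<close>
    have "derives ?\<tau> ?S (q (q (A x) (A y)) (A z) \<approx> q (A y) (A z))"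
      by (intro q_cong le_absorb A_refl) simp
    moreover have "derives ?\<tau> ?S (q (A y) (A z) \<approx> A z)"
      by (intro le_absorb) simp
    ultimately have "derives ?\<tau> ?S (q (q (A x) (A y)) (A z) \<approx> A z)"
      by (rule derives.trans)
    from replace_second[OF _ assms(3) this] lift[OF le] show ?thesis
      by (simp add: imp_iff eval p_def)
  qed

  have trans_backward: "derives \<sigma> T (le ?X (tt (tt ?X ?Y) ?Z))"
    if "strongly_determined \<sigma> T x y P t"
      and imp: "derives_imp \<sigma> T {le ?X ?Y, le ?Y ?Z} (le ?X ?Z)"
  proof -
    define w where "w = tt t ?Z"
    \<comment> \<open>The images x, t(x,y), t(t(x,y),z) form a chain: each further term is
      \<open>t\<close> of its predecessor and a variable, so strong determination yields both
      premises.\<close>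
    define c where "c = Var(y := t, z := w)"
    have w_term: "is_term \<sigma> w"
      unfolding w_def tt_def trm_at_def
      by (rule is_term_subst[OF assms(5)]) (simp add: assms(5))
    \<comment> \<open>As \<open>P\<close> contains only \<open>x\<close> and \<open>y\<close>, the
      value of \<open>c\<close> at \<open>z\<close> acts on the arguments \<open>s\<close> and
      \<open>u\<close> alone.\<close>
    have c_le: "subst_eqn c (le s u) = le (subst c s) (subst c u)" for s u
      unfolding le_def eqn_at_def subst_eqn_subst_eqn
      using assms(4) by (intro subst_eqn_cong_vars) auto
    have le_t: "derives \<sigma> T (le ?X t)"
      using that(1) by (simp add: strongly_determined_def le_def)
    \<comment> \<open>The second premise is x <= t(x,y) with \<open>t(x,y)\<close> for
      \<open>x\<close> and \<open>z\<close> for \<open>y\<close>, substituted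
      simultaneously.\<close>
    have "derives \<sigma> T (subst_eqn (Var(x := t, y := ?Z)) (le ?X t))"
      by (rule derives.inst[OF le_t]) (simp add: assms(5))
    also have "subst_eqn (Var(x := t, y := ?Z)) (le ?X t) = le t w"
      unfolding le_def eqn_at_def subst_eqn_subst_eqn w_def tt_def trm_at_def
      using assms(4) ne by (intro subst_eqn_cong_vars) auto
    finally have le_w: "derives \<sigma> T (le t w)" .
    have "derives \<sigma> T (subst_eqn c (le ?X ?Z))"
    proof (rule derives_imp_terms[OF imp])
      show "is_term \<sigma> (c i)" for i
        by (simp add: c_def assms(5) w_term)
      show "derives \<sigma> T (subst_eqn c Q)" if "Q \<in> {le ?X ?Y, le ?Y ?Z}" for Q
        using that le_t le_w ne by (auto simp: c_le) (simp_all add: c_def)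
    qed
    then show ?thesis
      using ne by (simp add: c_le) (simp add: c_def w_def tt_XY)
  qed

  show ?thesis
    unfolding Let_def
    using E_forward E_backward reflexive antisymmetric trans_forward trans_backward
    unfolding v_def le_def tt_def by blast
qed

end
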